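(* For any non-negative integer $N$, $$\begin{aligned} Rg(3,3,2;2N)&=rP(3,4,4;N)+rG(3,2,2;N-1),\\ Rg(3,3,2;2N+1)&=4\,Tg(6,6,1;N-1). \end{aligned}$$
   Context: $\mathbb{N}_0=\{0,1,2,\dots\}$. $t_n=n(n+1)/2$ (triangular numbers, $n\in\mathbb{N}_0$), $p_n=n(3n+1)/2$ (generalized pentagonal numbers, $n\in\mathbb{Z}$), $g_n=n(3n+2)$ (generalized octagonal numbers, $n\in\mathbb{Z}$). For positive integers $a_1,a_2,a_3$ and an integer $N$: $Rg(a_1,a_2,a_3;N)=|\{(l,m,n)\in\mathbb{Z}^3: N=a_1l^2+a_2m^2+a_3g_n\}|$; $rP(a_1,a_2,a_3;N)=|\{(l,m,n)\in\mathbb{Z}^3: N=a_1l^2+a_2p_m+a_3p_n\}|$; $rG(a_1,a_2,a_3;N)=|\{(l,m,n)\in\mathbb{Z}^3: N=a_1l^2+a_2g_m+a_3g_n\}|$; $Tg(a_1,a_2,a_3;N)=|\{(l,m,n)\in\mathbb{N}_0^2\times\mathbb{Z}: N=a_1t_l+a_2t_m+a_3g_n\}|$. In particular these counts are $0$ when $N<0$. *)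

theory Defs
  imports Main
begin

(* Both divisions below are exact, as n * (n + 1) and n * (3 * n + 1) are even. *)

definition tri :: "nat \<Rightarrow> int" where
  "tri n = int (n * (n + 1) div 2)"

definition pent :: "int \<Rightarrow> int" where
  "pent n = n * (3 * n + 1) div 2"

definition oct :: "int \<Rightarrow> int" where
  "oct n = n * (3 * n + 2)"

(* The counts below are meant for positive coefficients a1, a2, a3. All the figurate
   numbers involved are nonnegative and tend to infinity, so the sets are then finite
   and card is their true number of elements; for N < 0 they are empty. *)

definition Rg :: "int \<Rightarrow> int \<Rightarrow> int \<Rightarrow> int \<Rightarrow> nat" where
  "Rg a1 a2 a3 N =
    card {(l :: int, m :: int, n :: int). N = a1 * l\<^sup>2 + a2 * m\<^sup>2 + a3 * oct n}"

definition rP :: "int \<Rightarrow> int \<Rightarrow> int \<Rightarrow> int \<Rightarrow> nat" where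
  "rP a1 a2 a3 N =
    card {(l :: int, m :: int, n :: int). N = a1 * l\<^sup>2 + a2 * pent m + a3 * pent n}"

definition rG :: "int \<Rightarrow> int \<Rightarrow> int \<Rightarrow> int \<Rightarrow> nat" where
  "rG a1 a2 a3 N =
    card {(l :: int, m :: int, n :: int). N = a1 * l\<^sup>2 + a2 * oct m + a3 * oct n}"

definition Tg :: "int \<Rightarrow> int \<Rightarrow> int \<Rightarrow> int \<Rightarrow> nat" where
  "Tg a1 a2 a3 N =
    card {(l :: nat, m :: nat, n :: int). N = a1 * tri l + a2 * tri m + a3 * oct n}"

end

theory Submission
  imports Defs
begin

text \<open>If \<open>l \<equiv> m\<close> mod 2, put \<open>l = u + v\<close>, \<open>m = u - v\<close>: the representations of \<open>2 * N\<close> correspond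
  to \<open>N = 3 u\<^sup>2 + 3 v\<^sup>2 + g\<^sub>n\<close>, that is \<open>3 N + 1 = 9 u\<^sup>2 + (3 v)\<^sup>2 + (3 n + 1)\<^sup>2\<close>. These split according
  to whether \<open>v \<equiv> n\<close> mod 2. In the even case write \<open>v = a - b\<close>, \<open>n = a + b\<close>, so that
  \<open>(3 v)\<^sup>2 + (3 n + 1)\<^sup>2 = ((6 a + 1)\<^sup>2 + (6 b + 1)\<^sup>2) / 2\<close>; in the odd case write \<open>v = a - b\<close>,
  \<open>n = - (a + b + 1)\<close>, so that \<open>(3 v)\<^sup>2 + (3 n + 1)\<^sup>2 = 2 (3 a + 1)\<^sup>2 + 2 (3 b + 1)\<^sup>2\<close>.
  For \<open>2 * N + 1\<close> one puts \<open>l = a + b + 1\<close>, \<open>m = a - b\<close>, which turns \<open>3 l\<^sup>2 + 3 m\<^sup>2\<close> into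
  \<open>6 a (a + 1) + 6 b (b + 1) + 3\<close>; the symmetry \<open>a \<mapsto> - 1 - a\<close> in both variables gives the
  factor 4.\<close>

lemma two_pent: "2 * pent n = n * (3 * n + 1)"
proof -
  have "even (n * (3 * n + 1))" by auto
  then show ?thesis by (simp add: pent_def)
qed

lemma two_tri: "2 * tri n = int n * (int n + 1)"
proof -
  have "even (n * (n + 1))" by auto
  then have "2 * (n * (n + 1) div 2) = n * (n + 1)" by (rule dvd_mult_div_cancel)
  then have "int (2 * (n * (n + 1) div 2)) = int (n * (n + 1))" by (simp only:)
  then show ?thesis unfolding tri_def by (simp only: of_nat_mult of_nat_add of_nat_numeral of_nat_1)
qed

lemma abs_le_square: "\<bar>n :: int\<bar> \<le> n\<^sup>2"
proof (cases "n = 0")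
  case False
  then have "\<bar>n\<bar> * 1 \<le> \<bar>n\<bar> * \<bar>n\<bar>" by (intro mult_left_mono) auto
  then show ?thesis by (simp add: power2_eq_square)
qed simp

text \<open>Twice a product of consecutive integers, which is never negative, separates
  \<open>oct n\<close> from \<open>n\<^sup>2\<close>, so the bound for squares carries over.\<close>

lemma abs_le_oct: "\<bar>n\<bar> \<le> oct n"
proof -
  have "0 \<le> n * (n + 1)" by (cases "n \<ge> 0") (auto intro: mult_nonpos_nonpos)
  moreover have "oct n = n\<^sup>2 + 2 * (n * (n + 1))"
    by (simp add: oct_def power2_eq_square algebra_simps)
  ultimately show ?thesis using abs_le_square[of n] by linarith
qed

text \<open>Needed to add the cardinalities of the two parity classes. No term is negative and each
  bounds its variable, so all solutions lie in a box.\<close>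

lemma finite_square_square_oct:
  "finite {(u, v, n). N = 3 * u\<^sup>2 + 3 * v\<^sup>2 + oct n}"
proof (rule finite_subset)
  show "{(u, v, n). N = 3 * u\<^sup>2 + 3 * v\<^sup>2 + oct n} \<subseteq> {-N..N} \<times> {-N..N} \<times> {-N..N}"
  proof safe
    fix u v n :: int
    have "\<bar>u\<bar> \<le> u\<^sup>2" "\<bar>v\<bar> \<le> v\<^sup>2" "\<bar>n\<bar> \<le> oct n"
      by (rule abs_le_square abs_le_oct)+
    then show "u \<in> {- (3 * u\<^sup>2 + 3 * v\<^sup>2 + oct n)..3 * u\<^sup>2 + 3 * v\<^sup>2 + oct n}"
      and "v \<in> {- (3 * u\<^sup>2 + 3 * v\<^sup>2 + oct n)..3 * u\<^sup>2 + 3 * v\<^sup>2 + oct n}"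
      and "n \<in> {- (3 * u\<^sup>2 + 3 * v\<^sup>2 + oct n)..3 * u\<^sup>2 + 3 * v\<^sup>2 + oct n}"
      unfolding atLeastAtMost_iff by linarith+
  qed
qed simp

text \<open>A square has the parity of its base. Hence \<open>l\<close> and \<open>m\<close> agree
  in parity for the value \<open>2 * N\<close> and differ for \<open>2 * N + 1\<close>, which makes
  the halvings in the inverse maps exact.\<close>

lemma even_form_iff: "even (3 * l\<^sup>2 + 3 * m\<^sup>2 + 2 * g) \<longleftrightarrow> even (l + m)" for l m g :: int
  by simp

lemma Rg_even: "Rg 3 3 2 (2 * N) = card {(u, v, n). N = 3 * u\<^sup>2 + 3 * v\<^sup>2 + oct n}"
proof -
  have "bij_betw (\<lambda>(u, v, n). (u + v, u - v, n))
      {(u, v, n). N = 3 * u\<^sup>2 + 3 * v\<^sup>2 + oct n}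
      {(l, m, n). 2 * N = 3 * l\<^sup>2 + 3 * m\<^sup>2 + 2 * oct n}"
  proof (rule bij_betw_byWitness[where f' = "\<lambda>(l, m, n). ((l + m) div 2, (l - m) div 2, n)"])
    show "(\<lambda>(l, m, n). ((l + m) div 2, (l - m) div 2, n)) `
        {(l, m, n). 2 * N = 3 * l\<^sup>2 + 3 * m\<^sup>2 + 2 * oct n} \<subseteq>
        {(u, v, n). N = 3 * u\<^sup>2 + 3 * v\<^sup>2 + oct n}"
    proof clarsimp
      fix l m n :: int
      assume eq: "2 * N = 3 * l\<^sup>2 + 3 * m\<^sup>2 + 2 * oct n"
      then have "even (l + m)" by (metis even_form_iff dvd_triv_left)
      then obtain u where "l + m = 2 * u" by (elim evenE)
      \<comment> \<open>Eliminating \<open>l\<close> turns the two quotients into \<open>u\<close>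
        and \<open>u - m\<close>.\<close>
      then have l: "l = 2 * u - m" by simp
      from eq show "N = 3 * ((l + m) div 2)\<^sup>2 + 3 * ((l - m) div 2)\<^sup>2 + oct n"
        unfolding l by (simp add: power2_eq_square algebra_simps)
    qed
    show "\<forall>x\<in>{(l, m, n). 2 * N = 3 * l\<^sup>2 + 3 * m\<^sup>2 + 2 * oct n}.
        (case case x of (l, m, n) \<Rightarrow> ((l + m) div 2, (l - m) div 2, n) of
          (u, v, n) \<Rightarrow> (u + v, u - v, n)) = x"
    proof clarsimp
      fix l m n :: int
      assume eq: "2 * N = 3 * l\<^sup>2 + 3 * m\<^sup>2 + 2 * oct n"
      then have "even (l + m)" by (metis even_form_iff dvd_triv_left)
      then show "(l + m) div 2 + (l - m) div 2 = l \<and> (l + m) div 2 - (l - m) div 2 = m"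
        by presburger
    qed
  qed (auto simp: power2_eq_square algebra_simps)
  then show ?thesis unfolding Rg_def by (simp add: bij_betw_same_card)
qed

text \<open>In \<open>3 * (a - b)\<^sup>2 + oct (a + b)\<close> the mixed terms cancel, leaving
  \<open>4 * pent a + 4 * pent b\<close>.\<close>

lemma rP_eq_card:
  "rP 3 4 4 N = card {(u, v, n). N = 3 * u\<^sup>2 + 3 * v\<^sup>2 + oct n \<and> even (v + n)}"
proof -
  have four_pent: "4 * pent n = 2 * (n * (3 * n + 1))" for n
    using two_pent[of n] by simp
  have "bij_betw (\<lambda>(l, a, b). (l, a - b, a + b))
      {(l, a, b). N = 3 * l\<^sup>2 + 2 * (a * (3 * a + 1)) + 2 * (b * (3 * b + 1))}
      {(u, v, n). N = 3 * u\<^sup>2 + 3 * v\<^sup>2 + oct n \<and> even (v + n)}"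
  proof (rule bij_betw_byWitness[where f' = "\<lambda>(u, v, n). (u, (n + v) div 2, (n - v) div 2)"])
    show "(\<lambda>(u, v, n). (u, (n + v) div 2, (n - v) div 2)) `
        {(u, v, n). N = 3 * u\<^sup>2 + 3 * v\<^sup>2 + oct n \<and> even (v + n)} \<subseteq>
        {(l, a, b). N = 3 * l\<^sup>2 + 2 * (a * (3 * a + 1)) + 2 * (b * (3 * b + 1))}"
      unfolding image_subset_iff Ball_def split_paired_All mem_Collect_eq prod.case
    proof (intro allI impI, elim conjE)
      fix u v n :: int
      assume eq: "N = 3 * u\<^sup>2 + 3 * v\<^sup>2 + oct n" and "even (v + n)"
      from \<open>even (v + n)\<close> obtain a where "v + n = 2 * a" by (elim evenE)
      then have n: "n = 2 * a - v" by simp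
      show "N = 3 * u\<^sup>2 + 2 * ((n + v) div 2 * (3 * ((n + v) div 2) + 1)) +
          2 * ((n - v) div 2 * (3 * ((n - v) div 2) + 1))"
        unfolding eq n oct_def by (simp add: power2_eq_square algebra_simps)
    qed
    show "\<forall>x\<in>{(u, v, n). N = 3 * u\<^sup>2 + 3 * v\<^sup>2 + oct n \<and> even (v + n)}.
        (case case x of (u, v, n) \<Rightarrow> (u, (n + v) div 2, (n - v) div 2) of
          (l, a, b) \<Rightarrow> (l, a - b, a + b)) = x"
      by (clarsimp; presburger)
  qed (auto simp: oct_def power2_eq_square algebra_simps)
  then show ?thesis unfolding rP_def four_pent by (rule bij_betw_same_card)
qed

text \<open>For \<open>n = - (a + b + 1)\<close> one has
  \<open>3 * (a - b)\<^sup>2 + oct n = 2 * oct a + 2 * oct b + 1\<close>; the constant accounts for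
  the shift to \<open>N - 1\<close>.\<close>

lemma rG_eq_card:
  "rG 3 2 2 (N - 1) = card {(u, v, n). N = 3 * u\<^sup>2 + 3 * v\<^sup>2 + oct n \<and> odd (v + n)}"
proof -
  have "bij_betw (\<lambda>(l, a, b). (l, a - b, - (a + b + 1)))
      {(l, a, b). N - 1 = 3 * l\<^sup>2 + 2 * oct a + 2 * oct b}
      {(u, v, n). N = 3 * u\<^sup>2 + 3 * v\<^sup>2 + oct n \<and> odd (v + n)}"
  proof (rule bij_betw_byWitness[where
        f' = "\<lambda>(u, v, n). (u, (v - n - 1) div 2, (- v - n - 1) div 2)"])
    show "(\<lambda>(u, v, n). (u, (v - n - 1) div 2, (- v - n - 1) div 2)) `
        {(u, v, n). N = 3 * u\<^sup>2 + 3 * v\<^sup>2 + oct n \<and> odd (v + n)} \<subseteq>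
        {(l, a, b). N - 1 = 3 * l\<^sup>2 + 2 * oct a + 2 * oct b}"
      unfolding image_subset_iff Ball_def split_paired_All mem_Collect_eq prod.case
    proof (intro allI impI, elim conjE)
      fix u v n :: int
      assume eq: "N = 3 * u\<^sup>2 + 3 * v\<^sup>2 + oct n" and "odd (v + n)"
      from \<open>odd (v + n)\<close> obtain a where "v + n = 2 * a + 1" by (elim oddE)
      then have n: "n = 2 * a + 1 - v" by simp
      \<comment> \<open>Here \<open>a\<close> is only the parity witness, not the first coordinate
        of a triple counted by \<open>rG\<close>.\<close>
      have "(v - n - 1) div 2 = v - a - 1" "(- v - n - 1) div 2 = - a - 1"
        unfolding n by presburger+
      then show "N - 1 = 3 * u\<^sup>2 + 2 * oct ((v - n - 1) div 2) + 2 * oct ((- v - n - 1) div 2)"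
        by (simp add: eq n oct_def power2_eq_square algebra_simps)
    qed
    show "\<forall>x\<in>{(u, v, n). N = 3 * u\<^sup>2 + 3 * v\<^sup>2 + oct n \<and> odd (v + n)}.
        (case case x of (u, v, n) \<Rightarrow> (u, (v - n - 1) div 2, (- v - n - 1) div 2) of
          (l, a, b) \<Rightarrow> (l, a - b, - (a + b + 1))) = x"
      by (clarsimp; presburger)
    show "\<forall>x\<in>{(l, a, b). N - 1 = 3 * l\<^sup>2 + 2 * oct a + 2 * oct b}.
        (case case x of (l, a, b) \<Rightarrow> (l, a - b, - (a + b + 1)) of
          (u, v, n) \<Rightarrow> (u, (v - n - 1) div 2, (- v - n - 1) div 2)) = x"
      by clarsimp
  qed (auto simp: oct_def power2_eq_square algebra_simps)
  then show ?thesis unfolding rG_def by (rule bij_betw_same_card)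
qed

text \<open>Taking the constant 3 of the substituted form away from \<open>2 * N + 1\<close> leaves
  \<open>2 * (N - 1)\<close>, and the rest is halved.\<close>

lemma Rg_odd:
  "Rg 3 3 2 (2 * N + 1) =
    card {(a, b, n). N - 1 = 3 * (a * (a + 1)) + 3 * (b * (b + 1)) + oct n}"
proof -
  have "bij_betw (\<lambda>(a, b, n). (a + b + 1, a - b, n))
      {(a, b, n). N - 1 = 3 * (a * (a + 1)) + 3 * (b * (b + 1)) + oct n}
      {(l, m, n). 2 * N + 1 = 3 * l\<^sup>2 + 3 * m\<^sup>2 + 2 * oct n}"
  proof (rule bij_betw_byWitness[where
        f' = "\<lambda>(l, m, n). ((l + m - 1) div 2, (l - m - 1) div 2, n)"])
    have odd_sum: "odd (l + m)" if "2 * N + 1 = 3 * l\<^sup>2 + 3 * m\<^sup>2 + 2 * oct n" for l m n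
      using that even_form_iff[of l m "oct n"] by (metis even_plus_one_iff dvd_triv_left)
    show "(\<lambda>(l, m, n). ((l + m - 1) div 2, (l - m - 1) div 2, n)) `
        {(l, m, n). 2 * N + 1 = 3 * l\<^sup>2 + 3 * m\<^sup>2 + 2 * oct n} \<subseteq>
        {(a, b, n). N - 1 = 3 * (a * (a + 1)) + 3 * (b * (b + 1)) + oct n}"
    proof (rule image_subsetI, clarify)
      fix l m n
      assume eq: "2 * N + 1 = 3 * l\<^sup>2 + 3 * m\<^sup>2 + 2 * oct n"
      then have "odd (l + m)" by (rule odd_sum)
      then obtain a where "l + m = 2 * a + 1" by (elim oddE)
      then have l: "l = 2 * a + 1 - m" by simp
      have "(l + m - 1) div 2 = a" "(l - m - 1) div 2 = a - m"
        unfolding l by presburger+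
      with eq show "N - 1 = 3 * ((l + m - 1) div 2 * ((l + m - 1) div 2 + 1)) +
          3 * ((l - m - 1) div 2 * ((l - m - 1) div 2 + 1)) + oct n"
        by (simp add: l power2_eq_square algebra_simps)
    qed
    show "\<forall>x\<in>{(l, m, n). 2 * N + 1 = 3 * l\<^sup>2 + 3 * m\<^sup>2 + 2 * oct n}.
        (case case x of (l, m, n) \<Rightarrow> ((l + m - 1) div 2, (l - m - 1) div 2, n) of
          (a, b, n) \<Rightarrow> (a + b + 1, a - b, n)) = x"
      by (clarsimp dest!: odd_sum; presburger)
  qed (auto simp: power2_eq_square algebra_simps)
  then show ?thesis unfolding Rg_def by (simp add: bij_betw_same_card)
qed

text \<open>The reflection of \<open>z\<close> to \<open>- 1 - z\<close> has no fixed integer and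
  swaps the nonnegative with the negative ones, so every integer has exactly one code; a plain sign
  would give 0 two.\<close>

definition int_of_half :: "bool \<Rightarrow> nat \<Rightarrow> int" where
  "int_of_half s k = (if s then int k else - 1 - int k)"

lemma int_of_half_pronic: "int_of_half s k * (int_of_half s k + 1) = int k * (int k + 1)"
  by (simp add: int_of_half_def algebra_simps)

lemma int_of_half_inverse: "int_of_half (z \<ge> 0) (nat (if z \<ge> 0 then z else - 1 - z)) = z"
  by (simp add: int_of_half_def)

text \<open>The second equation branches on \<open>s\<close> because the first has by then rewritten
  the sign test.\<close>

lemma half_of_int_of_half:
  "int_of_half s k \<ge> 0 \<longleftrightarrow> s"
  "nat (if s then int_of_half s k else - 1 - int_of_half s k) = k"
  by (auto simp: int_of_half_def)

text \<open>The factor 4 counts the pairs of sides on which \<open>a\<close> and \<open>b\<close>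
  may lie; \<open>a * (a + 1)\<close> is the same on both sides.\<close>

lemma card_pronic_pronic_oct:
  "card {(a, b, n). M = 3 * (a * (a + 1)) + 3 * (b * (b + 1)) + oct n} = 4 * Tg 6 6 1 M"
proof -
  let ?T = "{(l, m, n). M = 6 * tri l + 6 * tri m + 1 * oct n}"
  let ?half = "\<lambda>z :: int. nat (if z \<ge> 0 then z else - 1 - z)"
  have six_tri: "6 * tri k = 3 * (int k * (int k + 1))" for k
    using two_tri[of k] by simp
  let ?Z = "{(a, b, n). M = 3 * (a * (a + 1)) + 3 * (b * (b + 1)) + oct n}"
  let ?f = "\<lambda>((s, t), l, m, n). (int_of_half s l, int_of_half t m, n)"
  let ?g = "\<lambda>(a, b, n). ((a \<ge> 0, b \<ge> 0), ?half a, ?half b, n)"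
  have "bij_betw ?f (UNIV \<times> ?T) ?Z"
  proof (rule bij_betw_byWitness[where f' = ?g])
    show "\<forall>x\<in>UNIV \<times> ?T. ?g (?f x) = x"
      by (auto simp only: half_of_int_of_half prod.case)
    show "\<forall>x\<in>?Z. ?f (?g x) = x"
      by (auto simp only: int_of_half_inverse prod.case)
    show "?f ` (UNIV \<times> ?T) \<subseteq> ?Z"
      by (auto simp only: int_of_half_pronic six_tri prod.case mem_Collect_eq mult_1)
    have "6 * tri (?half z) = 3 * (z * (z + 1))" for z
      using int_of_half_pronic[of "z \<ge> 0" "?half z"]
      unfolding int_of_half_inverse by (simp only: six_tri)
    then show "?g ` ?Z \<subseteq> UNIV \<times> ?T"
      by (auto simp only: prod.case mem_Collect_eq mem_Times_iff fst_conv snd_conv mult_1)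
  qed
  then have "card ?Z = card (UNIV \<times> ?T :: ((bool \<times> bool) \<times> nat \<times> nat \<times> int) set)"
    by (rule bij_betw_same_card[symmetric])
  moreover have "card (UNIV :: (bool \<times> bool) set) = 4"
    unfolding UNIV_Times_UNIV[symmetric] card_cartesian_product by simp
  ultimately show ?thesis
    unfolding Tg_def by (simp only: card_cartesian_product)
qed

theorem theorem5p12:
  fixes N :: int
  assumes "N \<ge> 0"
  shows "Rg 3 3 2 (2 * N) = rP 3 4 4 N + rG 3 2 2 (N - 1) \<and>
         Rg 3 3 2 (2 * N + 1) = 4 * Tg 6 6 1 (N - 1)"
proof
  let ?S = "{(u, v, n). N = 3 * u\<^sup>2 + 3 * v\<^sup>2 + oct n}"
  let ?E = "{(u, v, n). N = 3 * u\<^sup>2 + 3 * v\<^sup>2 + oct n \<and> even (v + n)}"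
  let ?O = "{(u, v, n). N = 3 * u\<^sup>2 + 3 * v\<^sup>2 + oct n \<and> odd (v + n)}"
  \<comment> \<open>The parity of \<open>v + n\<close> splits the solutions into the pentagonal and
    the octagonal class.\<close>
  have "finite ?E" "finite ?O"
    by (rule finite_subset[OF _ finite_square_square_oct[of N]], auto)+
  moreover have "?E \<inter> ?O = {}" and "?S = ?E \<union> ?O" by auto
  ultimately have "card ?S = card ?E + card ?O" by (simp only: card_Un_disjoint)
  then show "Rg 3 3 2 (2 * N) = rP 3 4 4 N + rG 3 2 2 (N - 1)"
    by (simp only: Rg_even rP_eq_card rG_eq_card)
  show "Rg 3 3 2 (2 * N + 1) = 4 * Tg 6 6 1 (N - 1)"
    by (simp only: Rg_odd card_pronic_pronic_oct)
qed

end
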